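(* Let $k$ be a commutative ring with unit, $A$ an associative unital $k$-algebra, $M$ an $A$-bimodule (symmetric over $k$), and $f: A\times A\to M$ a Hochschild 2-cocycle of $A$ with coefficients in $M$. Let $B=A+M$ be the $k$-algebra corresponding to the $k$-allowable singular extension of $A$ by $M$ defined by $f$. Then: 1) $B$ is nil-clean if and only if $A$ is nil-clean. 2) $B$ is clean if and only if $A$ is clean. 3) $B$ is exchange if and only if $A$ is exchange.
   Context: Bimodules $M$ over $A$ are symmetric over $k$: $cm=mc$ for $c\in k$, $m\in M$. A Hochschild 2-cocycle of $A$ with coefficients in $M$ (relative to $k$) is a $k$-bilinear map $f:A\times A\to M$ such that $af(b,c)-f(ab,c)+f(a,bc)-f(a,b)c=0$ for all $a,b,c\in A$. The $k$-algebra $B$ corresponding to the $k$-allowable singular extension of $A$ by $M$ defined by $f$ is the $k$-module direct sum $B=A+M$ (pairs $(a,m)$) with multiplication $(a,m)(a',m')=(aa',\,am'+ma'+f(a,a'))$; it is an associative algebra with unit $(1,-f(1,1))$. A unital ring $R$ is nil-clean if every $a\in R$ can be written $a=e+n$ with $e$ idempotent and $n$ nilpotent in $R$. It is clean if every $a\in R$ can be written $a=e+u$ with $e$ idempotent and $u$ invertible in $R$. It is exchange if for every $a\in R$ there is an idempotent $e\in R$ with $e\in aR$ and $1-e\in(1-a)R$. *)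

theory Defs
  imports "HOL-Algebra.Module" "HOL-Algebra.Coset"
begin

section \<open>Associative algebras, bimodules and Hochschild 2-cocycles\<close>

text \<open>
  The locale \<^locale>\<open>algebra\<close> of HOL-Algebra only covers commutative algebras.
\<close>

locale assoc_algebra = module k A + ring A for k (structure) and A (structure) +
  assumes smult_mult_left:
      "\<lbrakk> c \<in> carrier k; x \<in> carrier A; y \<in> carrier A \<rbrakk> \<Longrightarrow>
        (c \<odot>\<^bsub>A\<^esub> x) \<otimes>\<^bsub>A\<^esub> y = c \<odot>\<^bsub>A\<^esub> (x \<otimes>\<^bsub>A\<^esub> y)"
    and smult_mult_right:
      "\<lbrakk> c \<in> carrier k; x \<in> carrier A; y \<in> carrier A \<rbrakk> \<Longrightarrow>
        x \<otimes>\<^bsub>A\<^esub> (c \<odot>\<^bsub>A\<^esub> y) = c \<odot>\<^bsub>A\<^esub> (x \<otimes>\<^bsub>A\<^esub> y)"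

text \<open>
  As for modules in HOL-Algebra, the fields \<open>mult\<close> and \<open>one\<close> inherited from the ring
  record are ignored. The field \<open>smult\<close> is the action of the ground ring.
\<close>

record ('k, 'a, 'm) bimodule = "('k, 'm) module" +
  lact :: "'a \<Rightarrow> 'm \<Rightarrow> 'm" (infixr \<open>\<triangleright>\<index>\<close> 70)
  ract :: "'m \<Rightarrow> 'a \<Rightarrow> 'm" (infixl \<open>\<triangleleft>\<index>\<close> 70)

text \<open>
  The assumptions \<open>lact_scalar\<close> and \<open>ract_scalar\<close> express the symmetry over \<open>k\<close>:
  a scalar \<open>c\<close>, which acts through the element \<open>c 1\<close> of \<open>A\<close> on the left and on the right,
  satisfies \<open>c m = m c\<close>, and the common value is the \<open>k\<close>-module structure of \<open>M\<close>.
\<close>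

locale symmetric_bimodule = alg: assoc_algebra k A + mod: module k M
  for k :: "('k, 'x) ring_scheme"
    and A :: "('k, 'a, 'y) module_scheme"
    and M :: "('k, 'a, 'm, 'z) bimodule_scheme" +
  assumes lact_closed:
      "\<lbrakk> a \<in> carrier A; m \<in> carrier M \<rbrakk> \<Longrightarrow> a \<triangleright>\<^bsub>M\<^esub> m \<in> carrier M"
    and lact_add_left:
      "\<lbrakk> a \<in> carrier A; b \<in> carrier A; m \<in> carrier M \<rbrakk> \<Longrightarrow>
        (a \<oplus>\<^bsub>A\<^esub> b) \<triangleright>\<^bsub>M\<^esub> m = (a \<triangleright>\<^bsub>M\<^esub> m) \<oplus>\<^bsub>M\<^esub> (b \<triangleright>\<^bsub>M\<^esub> m)"
    and lact_add_right:
      "\<lbrakk> a \<in> carrier A; m \<in> carrier M; n \<in> carrier M \<rbrakk> \<Longrightarrow>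
        a \<triangleright>\<^bsub>M\<^esub> (m \<oplus>\<^bsub>M\<^esub> n) = (a \<triangleright>\<^bsub>M\<^esub> m) \<oplus>\<^bsub>M\<^esub> (a \<triangleright>\<^bsub>M\<^esub> n)"
    and lact_mult:
      "\<lbrakk> a \<in> carrier A; b \<in> carrier A; m \<in> carrier M \<rbrakk> \<Longrightarrow>
        (a \<otimes>\<^bsub>A\<^esub> b) \<triangleright>\<^bsub>M\<^esub> m = a \<triangleright>\<^bsub>M\<^esub> (b \<triangleright>\<^bsub>M\<^esub> m)"
    and lact_one:
      "m \<in> carrier M \<Longrightarrow> \<one>\<^bsub>A\<^esub> \<triangleright>\<^bsub>M\<^esub> m = m"
    and ract_closed:
      "\<lbrakk> m \<in> carrier M; a \<in> carrier A \<rbrakk> \<Longrightarrow> m \<triangleleft>\<^bsub>M\<^esub> a \<in> carrier M"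
    and ract_add_left:
      "\<lbrakk> m \<in> carrier M; n \<in> carrier M; a \<in> carrier A \<rbrakk> \<Longrightarrow>
        (m \<oplus>\<^bsub>M\<^esub> n) \<triangleleft>\<^bsub>M\<^esub> a = (m \<triangleleft>\<^bsub>M\<^esub> a) \<oplus>\<^bsub>M\<^esub> (n \<triangleleft>\<^bsub>M\<^esub> a)"
    and ract_add_right:
      "\<lbrakk> m \<in> carrier M; a \<in> carrier A; b \<in> carrier A \<rbrakk> \<Longrightarrow>
        m \<triangleleft>\<^bsub>M\<^esub> (a \<oplus>\<^bsub>A\<^esub> b) = (m \<triangleleft>\<^bsub>M\<^esub> a) \<oplus>\<^bsub>M\<^esub> (m \<triangleleft>\<^bsub>M\<^esub> b)"
    and ract_mult:
      "\<lbrakk> m \<in> carrier M; a \<in> carrier A; b \<in> carrier A \<rbrakk> \<Longrightarrow>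
        m \<triangleleft>\<^bsub>M\<^esub> (a \<otimes>\<^bsub>A\<^esub> b) = (m \<triangleleft>\<^bsub>M\<^esub> a) \<triangleleft>\<^bsub>M\<^esub> b"
    and ract_one:
      "m \<in> carrier M \<Longrightarrow> m \<triangleleft>\<^bsub>M\<^esub> \<one>\<^bsub>A\<^esub> = m"
    and lact_ract:
      "\<lbrakk> a \<in> carrier A; m \<in> carrier M; b \<in> carrier A \<rbrakk> \<Longrightarrow>
        (a \<triangleright>\<^bsub>M\<^esub> m) \<triangleleft>\<^bsub>M\<^esub> b = a \<triangleright>\<^bsub>M\<^esub> (m \<triangleleft>\<^bsub>M\<^esub> b)"
    and lact_scalar:
      "\<lbrakk> c \<in> carrier k; m \<in> carrier M \<rbrakk> \<Longrightarrow>
        (c \<odot>\<^bsub>A\<^esub> \<one>\<^bsub>A\<^esub>) \<triangleright>\<^bsub>M\<^esub> m = c \<odot>\<^bsub>M\<^esub> m"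
    and ract_scalar:
      "\<lbrakk> c \<in> carrier k; m \<in> carrier M \<rbrakk> \<Longrightarrow>
        m \<triangleleft>\<^bsub>M\<^esub> (c \<odot>\<^bsub>A\<^esub> \<one>\<^bsub>A\<^esub>) = c \<odot>\<^bsub>M\<^esub> m"

definition bilinear_map ::
    "('k, 'x) ring_scheme \<Rightarrow> ('k, 'a, 'p) module_scheme \<Rightarrow> ('k, 'b, 'q) module_scheme \<Rightarrow>
      ('k, 'm, 'r) module_scheme \<Rightarrow> ('a \<Rightarrow> 'b \<Rightarrow> 'm) \<Rightarrow> bool"
  where "bilinear_map k L N M f \<longleftrightarrow>
    (\<forall>a \<in> carrier L. \<forall>b \<in> carrier N. f a b \<in> carrier M) \<and>
    (\<forall>a \<in> carrier L. \<forall>a' \<in> carrier L. \<forall>b \<in> carrier N.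
      f (a \<oplus>\<^bsub>L\<^esub> a') b = f a b \<oplus>\<^bsub>M\<^esub> f a' b) \<and>
    (\<forall>a \<in> carrier L. \<forall>b \<in> carrier N. \<forall>b' \<in> carrier N.
      f a (b \<oplus>\<^bsub>N\<^esub> b') = f a b \<oplus>\<^bsub>M\<^esub> f a b') \<and>
    (\<forall>c \<in> carrier k. \<forall>a \<in> carrier L. \<forall>b \<in> carrier N.
      f (c \<odot>\<^bsub>L\<^esub> a) b = c \<odot>\<^bsub>M\<^esub> f a b \<and> f a (c \<odot>\<^bsub>N\<^esub> b) = c \<odot>\<^bsub>M\<^esub> f a b)"

definition hochschild_2_cocycle ::
    "('k, 'x) ring_scheme \<Rightarrow> ('k, 'a, 'y) module_scheme \<Rightarrow>
      ('k, 'a, 'm, 'z) bimodule_scheme \<Rightarrow> ('a \<Rightarrow> 'a \<Rightarrow> 'm) \<Rightarrow> bool"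
  where "hochschild_2_cocycle k A M f \<longleftrightarrow>
    bilinear_map k A A M f \<and>
    (\<forall>a \<in> carrier A. \<forall>b \<in> carrier A. \<forall>c \<in> carrier A.
      (a \<triangleright>\<^bsub>M\<^esub> f b c) \<ominus>\<^bsub>M\<^esub> f (a \<otimes>\<^bsub>A\<^esub> b) c \<oplus>\<^bsub>M\<^esub> f a (b \<otimes>\<^bsub>A\<^esub> c) \<ominus>\<^bsub>M\<^esub> (f a b \<triangleleft>\<^bsub>M\<^esub> c)
        = \<zero>\<^bsub>M\<^esub>)"

definition singular_extension ::
    "('k, 'a, 'y) module_scheme \<Rightarrow> ('k, 'a, 'm, 'z) bimodule_scheme \<Rightarrow> ('a \<Rightarrow> 'a \<Rightarrow> 'm) \<Rightarrow>
      ('k, 'a \<times> 'm) module"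
  where "singular_extension A M f =
    \<lparr> carrier = carrier A \<times> carrier M,
      mult = (\<lambda>(a, m) (a', m').
        (a \<otimes>\<^bsub>A\<^esub> a', (a \<triangleright>\<^bsub>M\<^esub> m') \<oplus>\<^bsub>M\<^esub> (m \<triangleleft>\<^bsub>M\<^esub> a') \<oplus>\<^bsub>M\<^esub> f a a')),
      one = (\<one>\<^bsub>A\<^esub>, \<ominus>\<^bsub>M\<^esub> f \<one>\<^bsub>A\<^esub> \<one>\<^bsub>A\<^esub>),
      zero = (\<zero>\<^bsub>A\<^esub>, \<zero>\<^bsub>M\<^esub>),
      add = (\<lambda>(a, m) (a', m'). (a \<oplus>\<^bsub>A\<^esub> a', m \<oplus>\<^bsub>M\<^esub> m')),
      smult = (\<lambda>c (a, m). (c \<odot>\<^bsub>A\<^esub> a, c \<odot>\<^bsub>M\<^esub> m)) \<rparr>"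

section \<open>Nil-clean, clean and exchange rings\<close>

definition idempotents :: "('a, 'x) ring_scheme \<Rightarrow> 'a set"
  where "idempotents R = {e \<in> carrier R. e \<otimes>\<^bsub>R\<^esub> e = e}"

definition nilpotents :: "('a, 'x) ring_scheme \<Rightarrow> 'a set"
  where "nilpotents R = {x \<in> carrier R. \<exists>n::nat. x [^]\<^bsub>R\<^esub> n = \<zero>\<^bsub>R\<^esub>}"

definition nil_clean :: "('a, 'x) ring_scheme \<Rightarrow> bool"
  where "nil_clean R \<longleftrightarrow>
    (\<forall>a \<in> carrier R. \<exists>e \<in> idempotents R. \<exists>n \<in> nilpotents R. a = e \<oplus>\<^bsub>R\<^esub> n)"

definition clean :: "('a, 'x) ring_scheme \<Rightarrow> bool"
  where "clean R \<longleftrightarrow>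
    (\<forall>a \<in> carrier R. \<exists>e \<in> idempotents R. \<exists>u \<in> Units R. a = e \<oplus>\<^bsub>R\<^esub> u)"

definition exchange :: "('a, 'x) ring_scheme \<Rightarrow> bool"
  where "exchange R \<longleftrightarrow>
    (\<forall>a \<in> carrier R. \<exists>e \<in> idempotents R.
      e \<in> a <#\<^bsub>R\<^esub> carrier R \<and> \<one>\<^bsub>R\<^esub> \<ominus>\<^bsub>R\<^esub> e \<in> (\<one>\<^bsub>R\<^esub> \<ominus>\<^bsub>R\<^esub> a) <#\<^bsub>R\<^esub> carrier R)"

end

theory Submission
  imports Defs "HOL-Algebra.RingHom"
begin

text \<open>
  The projection from the singular extension onto the algebra is a surjective ring homomorphism
  whose kernel consists of elements of square zero. Along such a homomorphism units and
  nilpotent elements are reflected, and idempotents lift by Newton's method: if \<open>h x\<close> is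
  idempotent, then \<open>3 x\<^sup>2 - 2 x\<^sup>3\<close> is an idempotent lift of \<open>h x\<close> that lies in the right ideal
  generated by \<open>x\<close>. In the exchange case the lift \<open>g\<close> is then corrected to
  \<open>g + g y (1 - g)\<close>, where \<open>g y + (1 - a) t = 1\<close>.
\<close>

section \<open>Ring homomorphisms with square-zero kernel\<close>

text \<open>One Newton step for \<open>t^2 - t\<close> at \<open>x\<close>: the correction is a
  multiple of the error \<open>y = x^2 - x\<close>, which commutes with \<open>x\<close> and squares
  to zero, so the new error vanishes. Writing \<open>3x^2 - 2x^3\<close> as \<open>x (x c)\<close>
  keeps its membership in the right ideal \<open>x R\<close> visible.\<close>

lemma (in ring) idempotent_newton:
  assumes x: "x \<in> carrier R" and d: "(x \<otimes> x \<ominus> x) \<otimes> (x \<otimes> x \<ominus> x) = \<zero>"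
  defines "c \<equiv> \<one> \<oplus> \<one> \<oplus> \<one> \<ominus> (x \<oplus> x)"
  shows "x \<otimes> (x \<otimes> c) \<in> idempotents R"
proof -
  define y where "y = x \<otimes> x \<ominus> x"
  have y: "y \<in> carrier R" and xx: "x \<otimes> x = x \<oplus> y" and yy: "y \<otimes> y = \<zero>"
    using x d by (simp_all add: y_def, algebra)
  have xy: "x \<otimes> y = y \<otimes> x"
    unfolding y_def using x by algebra
  \<comment> \<open>The rules with a trailing factor \<open>z\<close> act inside right-nested
    products, where the bare equations for \<open>x y\<close>, \<open>x x\<close> and
    \<open>y y\<close> do not match.\<close>
  have yx: "y \<otimes> (x \<otimes> z) = x \<otimes> (y \<otimes> z)" if "z \<in> carrier R" for z
    using x y xy that by (metis m_assoc)
  have xxz: "x \<otimes> (x \<otimes> z) = x \<otimes> z \<oplus> y \<otimes> z" if "z \<in> carrier R" for z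
    using x y xx that by (metis m_assoc l_distr)
  have yyz: "y \<otimes> (y \<otimes> z) = \<zero>" if "z \<in> carrier R" for z
    using y yy that by (metis m_assoc l_null)
  \<comment> \<open>Replacing \<open>x x\<close> by \<open>x + y\<close> turns the cubic into
    \<open>x\<close> plus terms that contain \<open>y\<close>.\<close>
  have eq: "x \<otimes> (x \<otimes> c) = x \<oplus> y \<ominus> (x \<otimes> y \<oplus> x \<otimes> y)"
  proof -
    have "x \<otimes> (x \<otimes> c) = (x \<oplus> y) \<otimes> c"
      using x by (simp add: c_def flip: m_assoc xx)
    also have "\<dots> = (x \<oplus> y) \<oplus> (x \<oplus> y) \<oplus> (x \<oplus> y) \<ominus> ((x \<oplus> y) \<otimes> x \<oplus> (x \<oplus> y) \<otimes> x)"
      unfolding c_def using x y by (simp add: minus_eq r_distr r_minus) algebra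
    also have "(x \<oplus> y) \<otimes> x = x \<oplus> y \<oplus> x \<otimes> y"
      using x y by (simp add: l_distr xx xy)
    also have "(x \<oplus> y) \<oplus> (x \<oplus> y) \<oplus> (x \<oplus> y) \<ominus> (x \<oplus> y \<oplus> x \<otimes> y \<oplus> (x \<oplus> y \<oplus> x \<otimes> y))
        = x \<oplus> y \<ominus> (x \<otimes> y \<oplus> x \<otimes> y)"
      using x y by algebra
    finally show ?thesis .
  qed
  \<comment> \<open>The correction \<open>w\<close> is \<open>y (1 - 2x)\<close>. Since
    \<open>(1 - 2x)^2 = 1 + 4y\<close>, the derivative \<open>2x - 1\<close> is its own inverse
    modulo \<open>y\<close>, so Newton's formula requires no division.\<close>
  define w where "w = y \<ominus> (x \<otimes> y \<oplus> x \<otimes> y)"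
  have w: "w \<in> carrier R" using x y by (simp add: w_def)
  have ww: "w \<otimes> w = \<zero>"
    unfolding w_def using x y yy yx yyz xy xxz
    by (simp add: minus_eq l_distr r_distr m_assoc l_minus r_minus)
  have xw: "x \<otimes> w = \<ominus> (x \<otimes> y)"
    unfolding w_def using x y yy by (simp add: minus_eq r_distr r_minus xxz yyz) algebra
  have wx: "w \<otimes> x = \<ominus> (x \<otimes> y)"
    unfolding w_def using x y yy by (simp add: minus_eq l_distr l_minus m_assoc xy[symmetric] xxz) algebra
  have e: "x \<otimes> (x \<otimes> c) = x \<oplus> w"
    unfolding eq w_def using x y by algebra
  \<comment> \<open>The error \<open>y\<close> from \<open>x x = x + y\<close> and the two terms
    \<open>x w = w x = -x y\<close> add up to \<open>w\<close> again.\<close>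
  have "(x \<oplus> w) \<otimes> (x \<oplus> w) = x \<otimes> x \<oplus> x \<otimes> w \<oplus> w \<otimes> x \<oplus> w \<otimes> w"
    using x w by algebra
  also have "\<dots> = x \<oplus> w"
    unfolding ww xw wx xx unfolding w_def using x y by algebra
  finally show ?thesis using x w by (simp add: e idempotents_def)
qed

text \<open>The shape of \<open>p\<close> gives \<open>g p = p\<close> and \<open>p g = g\<close>,
  whence \<open>p p = (p g) p = g p = p\<close>. The correction stays in the right ideal of
  \<open>g\<close>, while the complement becomes a right multiple of \<open>1 - g y\<close>, an
  element that a suitable \<open>y\<close> brings under control.\<close>

lemma (in ring) exchange_correction:
  assumes g: "g \<in> idempotents R" and y: "y \<in> carrier R"
  defines "p \<equiv> g \<oplus> g \<otimes> (y \<otimes> (\<one> \<ominus> g))"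
  shows "p \<in> idempotents R" "\<one> \<ominus> p = (\<one> \<ominus> g \<otimes> y) \<otimes> (\<one> \<ominus> g)"
proof -
  have gc: "g \<in> carrier R" and gg: "g \<otimes> g = g" using g by (auto simp: idempotents_def)
  have ggz: "g \<otimes> (g \<otimes> z) = g \<otimes> z" if "z \<in> carrier R" for z
    using gc gg that by (metis m_assoc)
  have pc: "p \<in> carrier R" using gc y by (simp add: p_def)
  have gp: "g \<otimes> p = p"
    unfolding p_def using gc y by (simp add: r_distr gg ggz)
  have "(\<one> \<ominus> g) \<otimes> g = \<zero>" using gc gg by (simp add: minus_eq l_distr l_minus r_neg)
  then have pg: "p \<otimes> g = g"
    unfolding p_def using gc y by (simp add: l_distr m_assoc gg)
  have "p \<otimes> p = (p \<otimes> g) \<otimes> p" using gp gc pc by (simp add: m_assoc)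
  then show "p \<in> idempotents R" using pg gp pc by (simp add: idempotents_def)
  show "\<one> \<ominus> p = (\<one> \<ominus> g \<otimes> y) \<otimes> (\<one> \<ominus> g)"
    unfolding p_def using gc y by algebra
qed

lemma (in ring) one_plus_square_zero_inverse:
  assumes "z \<in> carrier R" "z \<otimes> z = \<zero>"
  shows "(\<one> \<oplus> z) \<otimes> (\<one> \<ominus> z) = \<one>" "(\<one> \<ominus> z) \<otimes> (\<one> \<oplus> z) = \<one>"
proof -
  have "(\<one> \<oplus> z) \<otimes> (\<one> \<ominus> z) = \<one> \<ominus> z \<otimes> z"
    using assms(1) by (simp add: minus_eq l_distr r_distr r_minus a_assoc minus_add r_neg2 r_neg1)
  then show "(\<one> \<oplus> z) \<otimes> (\<one> \<ominus> z) = \<one>" using assms(2) by (simp add: minus_eq)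
  have "(\<one> \<ominus> z) \<otimes> (\<one> \<oplus> z) = \<one> \<ominus> z \<otimes> z"
    using assms(1) by (simp add: minus_eq l_distr r_distr l_minus a_assoc minus_add r_neg2 r_neg1)
  then show "(\<one> \<ominus> z) \<otimes> (\<one> \<oplus> z) = \<one>" using assms(2) by (simp add: minus_eq)
qed

text \<open>The kernel condition speaks of squares of single elements only. This is weaker than
  asking all products of two kernel elements to vanish, and it suffices for every transfer
  below.\<close>

locale square_zero_surjection = ring_hom_ring +
  assumes surj: "h ` carrier R = carrier S"
    and kernel_square: "\<lbrakk> x \<in> carrier R; h x = \<zero>\<^bsub>S\<^esub> \<rbrakk> \<Longrightarrow> x \<otimes> x = \<zero>"
begin

section \<open>Images, reflection and lifting of elements\<close>

lemma hom_minus: "\<lbrakk> x \<in> carrier R; y \<in> carrier R \<rbrakk> \<Longrightarrow> h (x \<ominus> y) = h x \<ominus>\<^bsub>S\<^esub> h y"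
  by (simp add: R.minus_eq S.minus_eq)

lemma lift:
  assumes "s \<in> carrier S"
  obtains r where "r \<in> carrier R" "h r = s"
  using assms surj by (metis imageE)

lemma hom_pow: "x \<in> carrier R \<Longrightarrow> h (x [^] (n::nat)) = h x [^]\<^bsub>S\<^esub> n"
  by (induction n) simp_all

lemma hom_idempotents: "e \<in> idempotents R \<Longrightarrow> h e \<in> idempotents S"
  unfolding idempotents_def by (auto simp flip: hom_mult)

lemma hom_nilpotents: "x \<in> nilpotents R \<Longrightarrow> h x \<in> nilpotents S"
  unfolding nilpotents_def by (auto simp flip: hom_pow) (metis hom_zero)

lemma hom_Units: "u \<in> Units R \<Longrightarrow> h u \<in> Units S"
  unfolding Units_def by (auto simp flip: hom_mult) (metis hom_closed hom_mult hom_one)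

text \<open>Some power of \<open>x\<close> lies in the kernel and one further squaring kills it, so
  doubling the exponent is enough.\<close>

lemma nilpotents_reflect:
  assumes x: "x \<in> carrier R" and "h x \<in> nilpotents S"
  shows "x \<in> nilpotents R"
proof -
  obtain n :: nat where "h x [^]\<^bsub>S\<^esub> n = \<zero>\<^bsub>S\<^esub>" using assms by (auto simp: nilpotents_def)
  then have "x [^] n \<otimes> x [^] n = \<zero>" using x by (intro kernel_square) (simp_all add: hom_pow)
  then have "x [^] (n + n) = \<zero>" using x by (simp add: R.nat_pow_mult)
  then show ?thesis using x unfolding nilpotents_def by blast
qed

text \<open>The elements over \<open>1\<close> are \<open>1 + z\<close> with \<open>z\<close> in the
  kernel. As \<open>z^2 = 0\<close>, the inverse is the truncated geometric series
  \<open>1 - z\<close>.\<close>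

lemma one_fibre_inverse:
  assumes w: "w \<in> carrier R" and hw: "h w = \<one>\<^bsub>S\<^esub>"
  obtains v where "v \<in> carrier R" "w \<otimes> v = \<one>" "v \<otimes> w = \<one>"
proof -
  define z where "z = w \<ominus> \<one>"
  have z: "z \<in> carrier R" and wz: "w = \<one> \<oplus> z" using w by (simp add: z_def, unfold z_def) algebra
  have "h z = \<zero>\<^bsub>S\<^esub>" using w hw by (simp add: z_def hom_minus S.minus_eq S.r_neg)
  then have "z \<otimes> z = \<zero>" using z kernel_square by blast
  with z R.one_plus_square_zero_inverse[of z] show thesis
    by (intro that[of "\<one> \<ominus> z"]) (simp_all add: wz)
qed

text \<open>For a lift \<open>v\<close> of the inverse of \<open>h u\<close>, both
  \<open>u v\<close> and \<open>v u\<close> lie over \<open>1\<close> and are therefore invertible.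
  This yields a right inverse \<open>v p\<close> and a left inverse \<open>q v\<close> of
  \<open>u\<close>, and these must coincide.\<close>

lemma Units_reflect:
  assumes u: "u \<in> carrier R" and hu: "h u \<in> Units S"
  shows "u \<in> Units R"
proof -
  obtain t where t: "t \<in> carrier S" "t \<otimes>\<^bsub>S\<^esub> h u = \<one>\<^bsub>S\<^esub>" "h u \<otimes>\<^bsub>S\<^esub> t = \<one>\<^bsub>S\<^esub>"
    using hu by (auto simp: Units_def)
  obtain v where v: "v \<in> carrier R" "h v = t" using t lift by blast
  obtain p where p: "p \<in> carrier R" "(u \<otimes> v) \<otimes> p = \<one>"
    using u v t by (auto intro: one_fibre_inverse[of "u \<otimes> v"])
  obtain q where q: "q \<in> carrier R" "q \<otimes> (v \<otimes> u) = \<one>"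
    using u v t by (auto intro: one_fibre_inverse[of "v \<otimes> u"])
  have r: "u \<otimes> (v \<otimes> p) = \<one>" and l: "(q \<otimes> v) \<otimes> u = \<one>"
    using u v p q by (simp_all add: R.m_assoc)
  have "q \<otimes> v = v \<otimes> p"
    using R.inv_unique[OF l r] u v p q by simp
  then show ?thesis using r l u v p unfolding Units_def by auto
qed

text \<open>The lift is exposed as a right multiple of \<open>x\<close>, not merely as some preimage
  of \<open>h x\<close>: the exchange property depends on this extra information.\<close>

lemma idempotent_lift:
  assumes x: "x \<in> carrier R" and hx: "h x \<in> idempotents S"
  obtains r where "r \<in> carrier R" "x \<otimes> r \<in> idempotents R" "h (x \<otimes> r) = h x"
proof -
  define c where "c = \<one> \<oplus> \<one> \<oplus> \<one> \<ominus> (x \<oplus> x)"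
  have c: "c \<in> carrier R" using x by (simp add: c_def)
  have hh: "h x \<otimes>\<^bsub>S\<^esub> h x = h x" using hx by (simp add: idempotents_def)
  have "h (x \<otimes> x \<ominus> x) = \<zero>\<^bsub>S\<^esub>" using x hh by (simp add: hom_minus S.minus_eq S.r_neg)
  then have "(x \<otimes> x \<ominus> x) \<otimes> (x \<otimes> x \<ominus> x) = \<zero>" using x kernel_square by simp
  then have 1: "x \<otimes> (x \<otimes> c) \<in> idempotents R"
    unfolding c_def by (rule R.idempotent_newton[OF x])
  have S3: "t \<oplus>\<^bsub>S\<^esub> t \<oplus>\<^bsub>S\<^esub> t \<ominus>\<^bsub>S\<^esub> (t \<oplus>\<^bsub>S\<^esub> t) = t" if "t \<in> carrier S" for t
    using that by algebra
  \<comment> \<open>For the idempotent \<open>t = h x\<close>, the product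
    \<open>t t (3 - 2t)\<close> collapses to \<open>3t - 2t = t\<close>.\<close>
  have "h (x \<otimes> (x \<otimes> c)) = (h x \<otimes>\<^bsub>S\<^esub> h x) \<otimes>\<^bsub>S\<^esub> h c"
    using x c by (simp add: S.m_assoc)
  also have "\<dots> = h x \<oplus>\<^bsub>S\<^esub> h x \<oplus>\<^bsub>S\<^esub> h x \<ominus>\<^bsub>S\<^esub> (h x \<otimes>\<^bsub>S\<^esub> h x \<oplus>\<^bsub>S\<^esub> h x \<otimes>\<^bsub>S\<^esub> h x)"
    unfolding hh unfolding c_def using x
    by (simp add: hom_minus S.minus_eq S.r_distr S.r_minus S.a_assoc hh)
  also have "\<dots> = h x" unfolding hh using S3[OF hom_closed[OF x]] .
  finally show thesis using that[of "x \<otimes> c"] 1 x c by simp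
qed

lemma idempotent_preimage:
  assumes "e \<in> idempotents S"
  obtains e' where "e' \<in> idempotents R" "h e' = e"
proof -
  have "e \<in> carrier S" using assms by (simp add: idempotents_def)
  then obtain x where "x \<in> carrier R" "h x = e" using lift by blast
  then show thesis using idempotent_lift[of x] that assms by metis
qed

text \<open>Only the idempotent is lifted; the other summand is then forced to be
  \<open>b - e'\<close>, which lies over \<open>n\<close>. Nilpotency or invertibility of that
  summand can be read off from its image, so one decomposition serves both the nil-clean and the
  clean case.\<close>

lemma complement_lift:
  assumes b: "b \<in> carrier R" and e: "e \<in> idempotents S" and n: "n \<in> carrier S"
    and hb: "h b = e \<oplus>\<^bsub>S\<^esub> n"
  obtains e' n' where "e' \<in> idempotents R" "n' \<in> carrier R" "h n' = n" "b = e' \<oplus> n'"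
proof -
  obtain e' where e': "e' \<in> idempotents R" "h e' = e" using idempotent_preimage e by blast
  have c: "e' \<in> carrier R" "e \<in> carrier S" using e' e by (auto simp: idempotents_def)
  have "h (b \<ominus> e') = n" using b c e' n hb by (simp add: hom_minus) algebra
  moreover have "b = e' \<oplus> (b \<ominus> e')" using b c by algebra
  ultimately show thesis using that[of e' "b \<ominus> e'"] e' b c by simp
qed

section \<open>Transfer of the three ring properties\<close>

lemma nil_clean_iff: "nil_clean R \<longleftrightarrow> nil_clean S"
proof
  assume R: "nil_clean R"
  show "nil_clean S" unfolding nil_clean_def
  proof
    fix s assume "s \<in> carrier S"
    then obtain r where r: "r \<in> carrier R" "h r = s" using lift by blast
    obtain e n where en: "e \<in> idempotents R" "n \<in> nilpotents R" "r = e \<oplus> n"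
      using R r(1) unfolding nil_clean_def by blast
    then have "s = h e \<oplus>\<^bsub>S\<^esub> h n" using r(2) by (auto simp: idempotents_def nilpotents_def)
    then show "\<exists>e\<in>idempotents S. \<exists>n\<in>nilpotents S. s = e \<oplus>\<^bsub>S\<^esub> n"
      using en hom_idempotents hom_nilpotents by blast
  qed
next
  assume S: "nil_clean S"
  show "nil_clean R" unfolding nil_clean_def
  proof
    fix b assume b: "b \<in> carrier R"
    then obtain e n where en: "e \<in> idempotents S" "n \<in> nilpotents S" "h b = e \<oplus>\<^bsub>S\<^esub> n"
      using S unfolding nil_clean_def by (meson hom_closed)
    moreover have "n \<in> carrier S" using en by (simp add: nilpotents_def)
    ultimately obtain e' n' where *: "e' \<in> idempotents R" "n' \<in> carrier R" "h n' = n" "b = e' \<oplus> n'"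
      using complement_lift b by metis
    then show "\<exists>e\<in>idempotents R. \<exists>n\<in>nilpotents R. b = e \<oplus> n"
      using nilpotents_reflect en by blast
  qed
qed

lemma clean_iff: "clean R \<longleftrightarrow> clean S"
proof
  assume R: "clean R"
  show "clean S" unfolding clean_def
  proof
    fix s assume "s \<in> carrier S"
    then obtain r where r: "r \<in> carrier R" "h r = s" using lift by blast
    obtain e u where eu: "e \<in> idempotents R" "u \<in> Units R" "r = e \<oplus> u"
      using R r(1) unfolding clean_def by blast
    then have "s = h e \<oplus>\<^bsub>S\<^esub> h u" using r(2) by (auto simp: idempotents_def Units_def)
    then show "\<exists>e\<in>idempotents S. \<exists>u\<in>Units S. s = e \<oplus>\<^bsub>S\<^esub> u"
      using eu hom_idempotents hom_Units by blast
  qed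
next
  assume S: "clean S"
  show "clean R" unfolding clean_def
  proof
    fix b assume b: "b \<in> carrier R"
    then obtain e u where eu: "e \<in> idempotents S" "u \<in> Units S" "h b = e \<oplus>\<^bsub>S\<^esub> u"
      using S unfolding clean_def by (meson hom_closed)
    moreover have "u \<in> carrier S" using eu by (simp add: Units_def)
    ultimately obtain e' u' where *: "e' \<in> idempotents R" "u' \<in> carrier R" "h u' = u" "b = e' \<oplus> u'"
      using complement_lift b by metis
    then show "\<exists>e\<in>idempotents R. \<exists>u\<in>Units R. b = e \<oplus> u"
      using Units_reflect eu by blast
  qed
qed

lemma exchange_iff: "exchange R \<longleftrightarrow> exchange S"
proof
  assume R: "exchange R"
  show "exchange S" unfolding exchange_def
  proof
    fix s assume "s \<in> carrier S"
    then obtain r where r: "r \<in> carrier R" "h r = s" using lift by blast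
    obtain e where e: "e \<in> idempotents R" "e \<in> r <# carrier R" "\<one> \<ominus> e \<in> (\<one> \<ominus> r) <# carrier R"
      using R r(1) unfolding exchange_def by blast
    obtain x y where x: "x \<in> carrier R" "e = r \<otimes> x"
      and y: "y \<in> carrier R" "\<one> \<ominus> e = (\<one> \<ominus> r) \<otimes> y"
      using e by (auto simp: l_coset_def)
    have ec: "e \<in> carrier R" using e by (simp add: idempotents_def)
    have "h e = s \<otimes>\<^bsub>S\<^esub> h x" using x r by simp
    moreover have "h (\<one> \<ominus> e) = h ((\<one> \<ominus> r) \<otimes> y)" using y by simp
    then have "\<one>\<^bsub>S\<^esub> \<ominus>\<^bsub>S\<^esub> h e = (\<one>\<^bsub>S\<^esub> \<ominus>\<^bsub>S\<^esub> s) \<otimes>\<^bsub>S\<^esub> h y"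
      using y(1) r ec by (simp add: hom_minus)
    ultimately have "h e \<in> s <#\<^bsub>S\<^esub> carrier S"
      "\<one>\<^bsub>S\<^esub> \<ominus>\<^bsub>S\<^esub> h e \<in> (\<one>\<^bsub>S\<^esub> \<ominus>\<^bsub>S\<^esub> s) <#\<^bsub>S\<^esub> carrier S"
      using x y unfolding l_coset_def by auto
    then show "\<exists>e\<in>idempotents S. e \<in> s <#\<^bsub>S\<^esub> carrier S \<and>
        \<one>\<^bsub>S\<^esub> \<ominus>\<^bsub>S\<^esub> e \<in> (\<one>\<^bsub>S\<^esub> \<ominus>\<^bsub>S\<^esub> s) <#\<^bsub>S\<^esub> carrier S"
      using hom_idempotents e by blast
  qed
next
  assume S: "exchange S"
  show "exchange R" unfolding exchange_def
  proof
    fix b assume b: "b \<in> carrier R"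
    obtain e where e: "e \<in> idempotents S" "e \<in> h b <#\<^bsub>S\<^esub> carrier S"
      "\<one>\<^bsub>S\<^esub> \<ominus>\<^bsub>S\<^esub> e \<in> (\<one>\<^bsub>S\<^esub> \<ominus>\<^bsub>S\<^esub> h b) <#\<^bsub>S\<^esub> carrier S"
      using S b unfolding exchange_def by (meson hom_closed)
    then obtain r0 s0 where r0: "r0 \<in> carrier S" "e = h b \<otimes>\<^bsub>S\<^esub> r0"
      and s0: "s0 \<in> carrier S" "\<one>\<^bsub>S\<^esub> \<ominus>\<^bsub>S\<^esub> e = (\<one>\<^bsub>S\<^esub> \<ominus>\<^bsub>S\<^esub> h b) \<otimes>\<^bsub>S\<^esub> s0"
      by (auto simp: l_coset_def)
    obtain r where r: "r \<in> carrier R" "h r = r0" using lift r0 by blast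
    obtain s where s: "s \<in> carrier R" "h s = s0" using lift s0 by blast
    have hbr: "h (b \<otimes> r) = e" using b r r0 by simp
    \<comment> \<open>Lifting starts from \<open>b r\<close> instead of an arbitrary preimage of
      \<open>e\<close>, so that the resulting idempotent \<open>g\<close> lies in
      \<open>b R\<close>.\<close>
    obtain q where q: "q \<in> carrier R" "(b \<otimes> r) \<otimes> q \<in> idempotents R" "h ((b \<otimes> r) \<otimes> q) = e"
      using idempotent_lift[of "b \<otimes> r"] b r e(1) hbr by (metis R.m_closed)
    define g where "g = b \<otimes> (r \<otimes> q)"
    have g: "g \<in> idempotents R" "h g = e" using q b r by (simp_all add: g_def R.m_assoc)
    have gc: "g \<in> carrier R" using g by (simp add: idempotents_def)
    have ec: "e \<in> carrier S" using gc g by auto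
    \<comment> \<open>So far \<open>1 - g\<close> lies in \<open>(1 - b) R\<close> only up to the
      kernel. The element \<open>w\<close> lies over \<open>e + (1 - e) = 1\<close>, so it is
      invertible, and its inverse measures this defect.\<close>
    define w where "w = g \<oplus> (\<one> \<ominus> b) \<otimes> s"
    have w: "w \<in> carrier R" using gc b s by (simp add: w_def)
    have "h w = e \<oplus>\<^bsub>S\<^esub> (\<one>\<^bsub>S\<^esub> \<ominus>\<^bsub>S\<^esub> e)"
      unfolding w_def s0(2) using gc b s g by (simp add: hom_minus)
    also have "\<dots> = \<one>\<^bsub>S\<^esub>" using ec by algebra
    finally obtain y where y: "y \<in> carrier R" "w \<otimes> y = \<one>" using one_fibre_inverse w by blast
    \<comment> \<open>Expanding \<open>w y = 1\<close> gives \<open>g y + (1 - b) s y = 1\<close>,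
      which puts \<open>1 - g y\<close> into \<open>(1 - b) R\<close>.\<close>
    have "\<one> \<ominus> g \<otimes> y = w \<otimes> y \<ominus> g \<otimes> y" using y by simp
    also have "\<dots> = (\<one> \<ominus> b) \<otimes> (s \<otimes> y)" unfolding w_def using y(1) gc b s(1) by algebra
    finally have gy: "\<one> \<ominus> g \<otimes> y = (\<one> \<ominus> b) \<otimes> (s \<otimes> y)" .
    \<comment> \<open>The added term keeps the idempotent in \<open>g R\<close>, hence in
      \<open>b R\<close>, and changes the complement to \<open>(1 - g y) (1 - g)\<close>, which now
      lies in \<open>(1 - b) R\<close>.\<close>
    define p where "p = g \<oplus> g \<otimes> (y \<otimes> (\<one> \<ominus> g))"
    have p: "p \<in> idempotents R" "\<one> \<ominus> p = (\<one> \<ominus> g \<otimes> y) \<otimes> (\<one> \<ominus> g)"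
      unfolding p_def by (rule R.exchange_correction[OF g(1) y(1)])+
    have "p = b \<otimes> ((r \<otimes> q) \<otimes> (\<one> \<oplus> y \<otimes> (\<one> \<ominus> g)))"
      unfolding p_def using b r(1) q(1) y(1) gc by (simp add: g_def R.r_distr R.m_assoc)
    moreover have "\<one> \<ominus> p = (\<one> \<ominus> b) \<otimes> ((s \<otimes> y) \<otimes> (\<one> \<ominus> g))"
      unfolding p(2) gy using b s(1) y(1) gc by (simp add: R.m_assoc)
    moreover have "(r \<otimes> q) \<otimes> (\<one> \<oplus> y \<otimes> (\<one> \<ominus> g)) \<in> carrier R"
      "(s \<otimes> y) \<otimes> (\<one> \<ominus> g) \<in> carrier R"
      using r(1) q(1) y(1) gc s(1) by simp_all
    ultimately have "p \<in> b <# carrier R" "\<one> \<ominus> p \<in> (\<one> \<ominus> b) <# carrier R"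
      unfolding l_coset_def by blast+
    then show "\<exists>e\<in>idempotents R. e \<in> b <# carrier R \<and> \<one> \<ominus> e \<in> (\<one> \<ominus> b) <# carrier R"
      using p(1) by blast
  qed
qed

end

section \<open>The singular extension\<close>

locale cocycle_extension = symmetric_bimodule +
  fixes f
  assumes cocycle: "hochschild_2_cocycle k A M f"
begin

lemma f_closed: "\<lbrakk> a \<in> carrier A; b \<in> carrier A \<rbrakk> \<Longrightarrow> f a b \<in> carrier M"
  and f_add_left: "\<lbrakk> a \<in> carrier A; a' \<in> carrier A; b \<in> carrier A \<rbrakk> \<Longrightarrow>
    f (a \<oplus>\<^bsub>A\<^esub> a') b = f a b \<oplus>\<^bsub>M\<^esub> f a' b"
  and f_add_right: "\<lbrakk> a \<in> carrier A; b \<in> carrier A; b' \<in> carrier A \<rbrakk> \<Longrightarrow>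
    f a (b \<oplus>\<^bsub>A\<^esub> b') = f a b \<oplus>\<^bsub>M\<^esub> f a b'"
  using cocycle unfolding hochschild_2_cocycle_def bilinear_map_def by blast+

text \<open>Moving the two negative terms to the other side leaves a form without subtraction, which
  suits regrouping of sums by associativity and commutativity.\<close>

lemma cocycle_eq:
  assumes a: "a \<in> carrier A" and b: "b \<in> carrier A" and c: "c \<in> carrier A"
  shows "(a \<triangleright>\<^bsub>M\<^esub> f b c) \<oplus>\<^bsub>M\<^esub> f a (b \<otimes>\<^bsub>A\<^esub> c) = f (a \<otimes>\<^bsub>A\<^esub> b) c \<oplus>\<^bsub>M\<^esub> (f a b \<triangleleft>\<^bsub>M\<^esub> c)"
proof -
  have cl: "a \<triangleright>\<^bsub>M\<^esub> f b c \<in> carrier M" "f a (b \<otimes>\<^bsub>A\<^esub> c) \<in> carrier M"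
    "f (a \<otimes>\<^bsub>A\<^esub> b) c \<in> carrier M" "f a b \<triangleleft>\<^bsub>M\<^esub> c \<in> carrier M"
    using assms by (simp_all add: f_closed lact_closed ract_closed)
  have sub: "p \<oplus>\<^bsub>M\<^esub> r = q \<oplus>\<^bsub>M\<^esub> s" if "p \<ominus>\<^bsub>M\<^esub> q \<oplus>\<^bsub>M\<^esub> r \<ominus>\<^bsub>M\<^esub> s = \<zero>\<^bsub>M\<^esub>"
    "p \<in> carrier M" "q \<in> carrier M" "r \<in> carrier M" "s \<in> carrier M" for p q r s
  proof -
    have "p \<oplus>\<^bsub>M\<^esub> r = (p \<ominus>\<^bsub>M\<^esub> q \<oplus>\<^bsub>M\<^esub> r \<ominus>\<^bsub>M\<^esub> s) \<oplus>\<^bsub>M\<^esub> (q \<oplus>\<^bsub>M\<^esub> s)"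
      using that(2-) by (simp add: mod.M.minus_eq mod.M.a_ac mod.M.r_neg mod.M.l_neg mod.M.r_neg1 mod.M.r_neg2)
    then show ?thesis using that by simp
  qed
  show ?thesis
    using cocycle assms cl unfolding hochschild_2_cocycle_def by (intro sub) blast+
qed

section \<open>Zeros, negatives and the unit under the actions and the cocycle\<close>

lemma lact_zero: "a \<in> carrier A \<Longrightarrow> a \<triangleright>\<^bsub>M\<^esub> \<zero>\<^bsub>M\<^esub> = \<zero>\<^bsub>M\<^esub>"
  using lact_add_right[of a "\<zero>\<^bsub>M\<^esub>" "\<zero>\<^bsub>M\<^esub>"] lact_closed[of a "\<zero>\<^bsub>M\<^esub>"] by simp

lemma zero_ract: "a \<in> carrier A \<Longrightarrow> \<zero>\<^bsub>M\<^esub> \<triangleleft>\<^bsub>M\<^esub> a = \<zero>\<^bsub>M\<^esub>"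
  using ract_add_left[of "\<zero>\<^bsub>M\<^esub>" "\<zero>\<^bsub>M\<^esub>" a] ract_closed[of "\<zero>\<^bsub>M\<^esub>" a] by simp

lemma zero_lact: "m \<in> carrier M \<Longrightarrow> \<zero>\<^bsub>A\<^esub> \<triangleright>\<^bsub>M\<^esub> m = \<zero>\<^bsub>M\<^esub>"
  using lact_add_left[of "\<zero>\<^bsub>A\<^esub>" "\<zero>\<^bsub>A\<^esub>" m] lact_closed[of "\<zero>\<^bsub>A\<^esub>" m] by simp

lemma ract_zero: "m \<in> carrier M \<Longrightarrow> m \<triangleleft>\<^bsub>M\<^esub> \<zero>\<^bsub>A\<^esub> = \<zero>\<^bsub>M\<^esub>"
  using ract_add_right[of m "\<zero>\<^bsub>A\<^esub>" "\<zero>\<^bsub>A\<^esub>"] ract_closed[of m "\<zero>\<^bsub>A\<^esub>"] by simp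

lemma lact_minus: "\<lbrakk> a \<in> carrier A; m \<in> carrier M \<rbrakk> \<Longrightarrow> a \<triangleright>\<^bsub>M\<^esub> (\<ominus>\<^bsub>M\<^esub> m) = \<ominus>\<^bsub>M\<^esub> (a \<triangleright>\<^bsub>M\<^esub> m)"
  using lact_add_right[of a "\<ominus>\<^bsub>M\<^esub> m" m]
  by (simp add: mod.M.l_neg lact_zero lact_closed mod.M.minus_equality)

lemma minus_ract: "\<lbrakk> m \<in> carrier M; a \<in> carrier A \<rbrakk> \<Longrightarrow> (\<ominus>\<^bsub>M\<^esub> m) \<triangleleft>\<^bsub>M\<^esub> a = \<ominus>\<^bsub>M\<^esub> (m \<triangleleft>\<^bsub>M\<^esub> a)"
  using ract_add_left[of "\<ominus>\<^bsub>M\<^esub> m" m a]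
  by (simp add: mod.M.l_neg zero_ract ract_closed mod.M.minus_equality)

lemma f_zero: "f \<zero>\<^bsub>A\<^esub> \<zero>\<^bsub>A\<^esub> = \<zero>\<^bsub>M\<^esub>"
  using f_add_left[of "\<zero>\<^bsub>A\<^esub>" "\<zero>\<^bsub>A\<^esub>" "\<zero>\<^bsub>A\<^esub>"] f_closed[of "\<zero>\<^bsub>A\<^esub>" "\<zero>\<^bsub>A\<^esub>"] by simp

text \<open>This is the cocycle identity at \<open>(1, 1, a)\<close> after cancelling
  \<open>f 1 a\<close>. Together with its mirror image it explains why \<open>-f 1 1\<close> is the
  second component of the unit.\<close>

lemma f_one_left: "a \<in> carrier A \<Longrightarrow> f \<one>\<^bsub>A\<^esub> a = f \<one>\<^bsub>A\<^esub> \<one>\<^bsub>A\<^esub> \<triangleleft>\<^bsub>M\<^esub> a"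
  using cocycle_eq[of "\<one>\<^bsub>A\<^esub>" "\<one>\<^bsub>A\<^esub>" a] by (simp add: lact_one f_closed ract_closed)

text \<open>The mirror image comes from the triple \<open>(a, 1, 1)\<close>, where
  \<open>f a 1\<close> cancels.\<close>

lemma f_one_right: "a \<in> carrier A \<Longrightarrow> f a \<one>\<^bsub>A\<^esub> = a \<triangleright>\<^bsub>M\<^esub> f \<one>\<^bsub>A\<^esub> \<one>\<^bsub>A\<^esub>"
  using cocycle_eq[of a "\<one>\<^bsub>A\<^esub>" "\<one>\<^bsub>A\<^esub>"]
  by (simp add: ract_one f_closed lact_closed mod.M.a_comm)

section \<open>Ring structure of the extension and its projection\<close>

abbreviation "B \<equiv> singular_extension A M f"

lemma carrier_B: "carrier B = carrier A \<times> carrier M"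
  and zero_B: "\<zero>\<^bsub>B\<^esub> = (\<zero>\<^bsub>A\<^esub>, \<zero>\<^bsub>M\<^esub>)"
  and one_B: "\<one>\<^bsub>B\<^esub> = (\<one>\<^bsub>A\<^esub>, \<ominus>\<^bsub>M\<^esub> f \<one>\<^bsub>A\<^esub> \<one>\<^bsub>A\<^esub>)"
  and add_B: "(a, m) \<oplus>\<^bsub>B\<^esub> (a', m') = (a \<oplus>\<^bsub>A\<^esub> a', m \<oplus>\<^bsub>M\<^esub> m')"
  and mult_B: "(a, m) \<otimes>\<^bsub>B\<^esub> (a', m') =
    (a \<otimes>\<^bsub>A\<^esub> a', (a \<triangleright>\<^bsub>M\<^esub> m') \<oplus>\<^bsub>M\<^esub> (m \<triangleleft>\<^bsub>M\<^esub> a') \<oplus>\<^bsub>M\<^esub> f a a')"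
  by (simp_all add: singular_extension_def)

lemmas B_simps = carrier_B zero_B one_B add_B mult_B

text \<open>In the second component the three terms without \<open>f\<close> agree by the bimodule
  laws; they are collected in \<open>s\<close>. What remains on the two sides is exactly the two
  sides of \<open>cocycle_eq\<close>.\<close>

lemma B_assoc:
  assumes a: "a \<in> carrier A" and b: "b \<in> carrier A" and c: "c \<in> carrier A"
    and l: "l \<in> carrier M" and m: "m \<in> carrier M" and n: "n \<in> carrier M"
  shows "((a, l) \<otimes>\<^bsub>B\<^esub> (b, m)) \<otimes>\<^bsub>B\<^esub> (c, n) = (a, l) \<otimes>\<^bsub>B\<^esub> ((b, m) \<otimes>\<^bsub>B\<^esub> (c, n))"
proof -
  note cl = assms lact_closed ract_closed f_closed
  define s where "s = (a \<triangleright>\<^bsub>M\<^esub> (b \<triangleright>\<^bsub>M\<^esub> n)) \<oplus>\<^bsub>M\<^esub> (a \<triangleright>\<^bsub>M\<^esub> (m \<triangleleft>\<^bsub>M\<^esub> c)) \<oplus>\<^bsub>M\<^esub> ((l \<triangleleft>\<^bsub>M\<^esub> b) \<triangleleft>\<^bsub>M\<^esub> c)"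
  have s: "s \<in> carrier M" using cl by (simp add: s_def)
  have "((a \<otimes>\<^bsub>A\<^esub> b) \<triangleright>\<^bsub>M\<^esub> n) \<oplus>\<^bsub>M\<^esub> (((a \<triangleright>\<^bsub>M\<^esub> m) \<oplus>\<^bsub>M\<^esub> (l \<triangleleft>\<^bsub>M\<^esub> b) \<oplus>\<^bsub>M\<^esub> f a b) \<triangleleft>\<^bsub>M\<^esub> c) \<oplus>\<^bsub>M\<^esub> f (a \<otimes>\<^bsub>A\<^esub> b) c
      = s \<oplus>\<^bsub>M\<^esub> (f (a \<otimes>\<^bsub>A\<^esub> b) c \<oplus>\<^bsub>M\<^esub> (f a b \<triangleleft>\<^bsub>M\<^esub> c))"
    unfolding s_def using cl by (simp add: lact_mult ract_add_left lact_ract mod.M.a_ac)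
  also have "\<dots> = s \<oplus>\<^bsub>M\<^esub> ((a \<triangleright>\<^bsub>M\<^esub> f b c) \<oplus>\<^bsub>M\<^esub> f a (b \<otimes>\<^bsub>A\<^esub> c))"
    using assms by (simp add: cocycle_eq)
  also have "\<dots> = (a \<triangleright>\<^bsub>M\<^esub> ((b \<triangleright>\<^bsub>M\<^esub> n) \<oplus>\<^bsub>M\<^esub> (m \<triangleleft>\<^bsub>M\<^esub> c) \<oplus>\<^bsub>M\<^esub> f b c)) \<oplus>\<^bsub>M\<^esub> (l \<triangleleft>\<^bsub>M\<^esub> (b \<otimes>\<^bsub>A\<^esub> c)) \<oplus>\<^bsub>M\<^esub> f a (b \<otimes>\<^bsub>A\<^esub> c)"
    unfolding s_def using cl by (simp add: ract_mult lact_add_right mod.M.a_ac)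
  finally show ?thesis using assms by (simp add: mult_B alg.m_assoc)
qed

lemma ring_B: "ring B"
proof (rule ringI)
  show "abelian_group B"
  proof (rule abelian_groupI)
    fix x assume "x \<in> carrier B"
    then show "\<exists>y\<in>carrier B. y \<oplus>\<^bsub>B\<^esub> x = \<zero>\<^bsub>B\<^esub>"
      by (intro bexI[of _ "(\<ominus>\<^bsub>A\<^esub> fst x, \<ominus>\<^bsub>M\<^esub> snd x)"])
        (auto simp: B_simps alg.l_neg mod.M.l_neg)
  qed (auto simp: B_simps alg.a_ac mod.M.a_ac)
  show "monoid B"
  proof (rule monoidI)
    fix x y z assume "x \<in> carrier B" "y \<in> carrier B" "z \<in> carrier B"
    then show "x \<otimes>\<^bsub>B\<^esub> y \<otimes>\<^bsub>B\<^esub> z = x \<otimes>\<^bsub>B\<^esub> (y \<otimes>\<^bsub>B\<^esub> z)"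
      by (cases x; cases y; cases z) (auto simp: carrier_B intro: B_assoc)
  next
    fix x assume "x \<in> carrier B"
    then obtain a m where x: "x = (a, m)" and a: "a \<in> carrier A" and m: "m \<in> carrier M"
      by (auto simp: carrier_B)
    \<comment> \<open>Here \<open>q\<close> stands for \<open>f 1 1\<close> acted on by
      \<open>a\<close>, from the right for the left unit law and from the left for the right one. It
      enters negatively through the unit and positively through \<open>f 1 a\<close> or
      \<open>f a 1\<close>.\<close>
    have cancel: "m \<oplus>\<^bsub>M\<^esub> \<ominus>\<^bsub>M\<^esub> q \<oplus>\<^bsub>M\<^esub> q = m" "\<ominus>\<^bsub>M\<^esub> q \<oplus>\<^bsub>M\<^esub> m \<oplus>\<^bsub>M\<^esub> q = m" if "q \<in> carrier M" for q
      using that m by (simp_all add: mod.M.a_assoc mod.M.a_comm[of m] mod.M.l_neg mod.M.r_neg1)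
    show "\<one>\<^bsub>B\<^esub> \<otimes>\<^bsub>B\<^esub> x = x" "x \<otimes>\<^bsub>B\<^esub> \<one>\<^bsub>B\<^esub> = x"
      using a m by (simp_all add: x one_B mult_B lact_one ract_one lact_minus minus_ract
          f_one_left[OF a] f_one_right[OF a] f_closed lact_closed ract_closed cancel)
  qed (auto simp: B_simps f_closed lact_closed ract_closed)
qed (auto simp: B_simps alg.l_distr alg.r_distr lact_add_left lact_add_right ract_add_left
    ract_add_right f_add_left f_add_right f_closed lact_closed ract_closed mod.M.a_ac)

text \<open>An element of the kernel has the form \<open>(0, m)\<close>, and the second component of
  its square is \<open>0 m + m 0 + f 0 0\<close>, in which every term vanishes by
  additivity.\<close>

lemma projection: "square_zero_surjection B A fst"
proof -
  interpret ring_hom_ring B A fst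
    by (rule ring_hom_ringI[OF ring_B alg.ring_axioms]) (auto simp: B_simps)
  show ?thesis
  proof
    show "fst ` carrier B = carrier A"
      by (force simp: carrier_B intro: image_eqI[of _ fst "(_, \<zero>\<^bsub>M\<^esub>)"])
  next
    fix x assume "x \<in> carrier B" "fst x = \<zero>\<^bsub>A\<^esub>"
    then show "x \<otimes>\<^bsub>B\<^esub> x = \<zero>\<^bsub>B\<^esub>"
      by (auto simp: B_simps zero_lact ract_zero f_zero)
  qed
qed

end

theorem proposition1:
  fixes k :: "('k, 'x) ring_scheme"
    and A :: "('k, 'a, 'y) module_scheme"
    and M :: "('k, 'a, 'm, 'z) bimodule_scheme"
    and f :: "'a \<Rightarrow> 'a \<Rightarrow> 'm"
    and B :: "('k, 'a \<times> 'm) module"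
  assumes "cring k"
    and "assoc_algebra k A"
    and "symmetric_bimodule k A M"
    and "hochschild_2_cocycle k A M f"
    and "B = singular_extension A M f"
  shows "(nil_clean B \<longleftrightarrow> nil_clean A) \<and> (clean B \<longleftrightarrow> clean A) \<and> (exchange B \<longleftrightarrow> exchange A)"
proof -
  interpret cocycle_extension k A M f
    using assms(3,4) by (simp add: cocycle_extension_def cocycle_extension_axioms_def)
  interpret square_zero_surjection B A fst
    unfolding assms(5) by (rule projection)
  show ?thesis using nil_clean_iff clean_iff exchange_iff by blast
qed

end
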